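(* Let $q$ be a prime power and let $C_1$ and $C_2$ be two symplectic LCD $[2n,2k]_q$ codes. Then there exists a symplectic matrix $Q\in \mathbb{S}\mathrm{p}^1_{2n}(q)$ such that $C_2=C_1Q$. Conversely, for any symplectic LCD $[2n,2k]_q$ code $C$ and any symplectic matrix $Q\in \mathbb{S}\mathrm{p}^1_{2n}(q)$, $CQ$ is also a symplectic LCD $[2n,2k]_q$ code.
   Context: A linear $[m,k]_q$ code is a $k$-dimensional subspace of $\mathbb{F}_q^m$ (row vectors). On $\mathbb{F}_q^{2n}$ the symplectic inner product is $\langle \mathbf{x},\mathbf{y}\rangle_{\rm s}=\sum_{i=1}^n(x_iy_{n+i}-x_{n+i}y_i)=\mathbf{x}\Omega_n\mathbf{y}^T$, where $\Omega_n=\begin{pmatrix} O & I_n\\ -I_n & O\end{pmatrix}$. For a code $C\subseteq\mathbb{F}_q^{2n}$, $C^{\perp_{\rm s}}=\{\mathbf{y}\in\mathbb{F}_q^{2n} : \langle\mathbf{x},\mathbf{y}\rangle_{\rm s}=0\text{ for all }\mathbf{x}\in C\}$, and $C$ is symplectic LCD if $C\cap C^{\perp_{\rm s}}=\{\mathbf{0}\}$. For a $2n\times 2n$ matrix $Q$, $CQ=\{\mathbf{c}Q : \mathbf{c}\in C\}$. The symplectic group is $\mathbb{S}\mathrm{p}^1_{2n}(q)=\{Q\in \mathrm{GL}_{2n}(\mathbb{F}_q) : Q\Omega_nQ^T=\Omega_n\}$. *)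

theory Defs
  imports "HOL-Analysis.Analysis"
begin

text \<open>
  The field with \<open>q\<close> elements is a type \<open>'a\<close> of sort \<open>{field, finite}\<close> with \<open>CARD('a) = q\<close>.
  The row space \<open>F\<^sub>q\<^sup>2\<^sup>n\<close> is \<open>'a ^ ('n + 'n)\<close> with \<open>CARD('n) = n\<close>: the index \<open>Inl i\<close>
  stands for the position \<open>i\<close> and \<open>Inr i\<close> for the position \<open>n + i\<close>.
\<close>

definition linear_code :: "nat \<Rightarrow> nat \<Rightarrow> nat \<Rightarrow> ('a :: {field, finite} ^ 'm) set \<Rightarrow> bool" where
  "linear_code m k q C \<longleftrightarrow>
     CARD('m) = m \<and> CARD('a) = q \<and> vec.subspace C \<and> vec.dim C = k"

definition symp_form :: "'a :: field ^ ('n::finite + 'n) \<Rightarrow> 'a ^ ('n + 'n) \<Rightarrow> 'a" where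
  "symp_form x y = (\<Sum>i\<in>UNIV. x $ Inl i * y $ Inr i - x $ Inr i * y $ Inl i)"

definition symp_dual :: "('a :: field ^ ('n::finite + 'n)) set \<Rightarrow> ('a ^ ('n + 'n)) set" where
  "symp_dual C = {y. \<forall>x\<in>C. symp_form x y = 0}"

definition symp_LCD :: "('a :: field ^ ('n::finite + 'n)) set \<Rightarrow> bool" where
  "symp_LCD C \<longleftrightarrow> C \<inter> symp_dual C = {0}"

definition Omega :: "'a :: field ^ ('n::finite + 'n) ^ ('n + 'n)" where
  "Omega = (\<chi> r c. case (r, c) of
       (Inl i, Inr j) \<Rightarrow> if i = j then 1 else 0
     | (Inr i, Inl j) \<Rightarrow> if i = j then - 1 else 0
     | _ \<Rightarrow> 0)"

definition symp_group :: "('a :: field ^ ('n::finite + 'n) ^ ('n + 'n)) set" where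
  "symp_group = {Q. invertible Q \<and> Q ** Omega ** transpose Q = Omega}"

definition code_mult :: "('a :: field ^ 'm) set \<Rightarrow> 'a ^ 'm ^ 'm \<Rightarrow> ('a ^ 'm) set" where
  "code_mult C Q = (\<lambda>c. c v* Q) ` C"

lemma symp_form_eq_Omega:
  fixes x y :: "'a :: field ^ ('n::finite + 'n)"
  shows "symp_form x y = (\<Sum>c\<in>UNIV. (x v* Omega) $ c * y $ c)"
proof -
  have s: "(\<Sum>c\<in>UNIV. f c) = (\<Sum>i\<in>UNIV. f (Inl i)) + (\<Sum>i\<in>UNIV. f (Inr i))"
    for f :: "'n + 'n \<Rightarrow> 'a"
    using sum.Plus[of "UNIV :: 'n set" "UNIV :: 'n set" f] by simp
  have l: "(x v* Omega) $ Inl j = - x $ Inr j" and r: "(x v* Omega) $ Inr j = x $ Inl j" for j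
    by (simp_all add: s Omega_def vector_matrix_mult_def if_distrib[where f = "\<lambda>t. _ * t"]
        cong: if_cong)
  show ?thesis
    by (simp add: s l r symp_form_def sum_subtractf sum_negf)
qed

end

theory Submission
  imports Defs
begin

text \<open>
  Every symplectic LCD code of dimension \<open>2k\<close> has a symplectic basis, obtained by repeatedly splitting
  off hyperbolic planes, and since the ambient space is itself nondegenerate this basis extends to
  a symplectic basis of \<open>F\<^sub>q\<^sup>2\<^sup>n\<close>. Written as rows of matrices \<open>B\<^sub>1\<close>, \<open>B\<^sub>2\<close>, the extended bases of
  \<open>C\<^sub>1\<close> and \<open>C\<^sub>2\<close> satisfy \<open>B\<^sub>i \<Omega> B\<^sub>i\<^sup>T = \<Omega>\<close>, and \<open>Q = B\<^sub>1\<^sup>-\<^sup>1 B\<^sub>2\<close> is the required symplectic matrix.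
\<close>

subsection \<open>The symplectic form\<close>

lemma symp_form_add_left: "symp_form (x + y) z = symp_form x z + symp_form y z"
  by (simp add: symp_form_def algebra_simps sum.distrib sum_subtractf)

lemma symp_form_scale_left: "symp_form (c *s x) z = c * symp_form x z"
  by (simp add: symp_form_def algebra_simps sum_distrib_left)

lemma symp_form_swap: "symp_form y x = - symp_form x y"
  by (simp add: symp_form_def algebra_simps sum_negf [symmetric])

lemma symp_form_self: "symp_form x x = 0"
  by (simp add: symp_form_def algebra_simps)

lemma symp_form_zero_left: "symp_form 0 z = 0"
  by (simp add: symp_form_def)

lemma symp_form_diff_left: "symp_form (x - y) z = symp_form x z - symp_form y z"
  by (simp add: symp_form_def algebra_simps sum.distrib sum_subtractf)

lemma symp_form_scale_right: "symp_form z (c *s x) = c * symp_form z x"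
  by (simp add: symp_form_def algebra_simps sum_distrib_left)

lemma symp_form_diff_right: "symp_form z (x - y) = symp_form z x - symp_form z y"
  by (simp add: symp_form_def algebra_simps sum.distrib sum_subtractf)

lemma symp_form_sum_left: "symp_form (sum f I) z = (\<Sum>i\<in>I. symp_form (f i) z)"
  by (induction I rule: infinite_finite_induct)
     (simp_all add: symp_form_zero_left symp_form_add_left)

lemma symp_form_axis_right:
  "symp_form x (axis (Inr i) 1) = x $ Inl i"
  "symp_form x (axis (Inl i) 1) = - x $ Inr i"
  by (simp_all add: symp_form_def axis_def sum_negf if_distrib[where f = "\<lambda>t. _ * t"] cong: if_cong)

text \<open>This recasts LCD as nondegeneracy of the form restricted to \<open>C\<close>.
  Antisymmetry makes orthogonality independent of the side on which a vector stands.\<close>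

lemma symp_LCD_iff:
  assumes "vec.subspace C"
  shows "symp_LCD C \<longleftrightarrow> (\<forall>x\<in>C. x \<noteq> 0 \<longrightarrow> (\<exists>y\<in>C. symp_form x y \<noteq> 0))"
proof -
  have "0 \<in> C"
    using assms by (rule vec.subspace_0)
  moreover have "x \<in> symp_dual C \<longleftrightarrow> (\<forall>y\<in>C. symp_form x y = 0)" for x
    by (simp add: symp_dual_def symp_form_swap[of _ x])
  ultimately show ?thesis
    unfolding symp_LCD_def using symp_form_zero_left by blast
qed

text \<open>Pairing with unit vectors reads off every coordinate up to sign, so only 0 is orthogonal
  to everything.\<close>

lemma symp_LCD_UNIV: "symp_LCD (UNIV :: ('a::field ^ ('n::finite + 'n)) set)"
proof -
  have "\<exists>y. symp_form x y \<noteq> 0" if "x \<noteq> 0" for x :: "'a ^ ('n + 'n)"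
  proof (rule ccontr)
    assume "\<not> ?thesis"
    then have "x $ r = 0" for r
      by (cases r) (metis symp_form_axis_right neg_equal_0_iff_equal)+
    with that show False
      by (simp add: vec_eq_iff)
  qed
  then show ?thesis
    by (simp add: symp_LCD_iff)
qed

subsection \<open>The symplectic group\<close>

lemma row_matrix_mult: "(A ** B) $ r = A $ r v* B"
  by (simp add: vec_eq_iff matrix_matrix_mult_def vector_matrix_mult_def mult.commute)

text \<open>The bridge between matrices and bases: \<open>B ** Omega ** transpose B = Omega\<close>
  says precisely that the rows of \<open>B\<close> form a symplectic basis.\<close>

lemma gram_matrix: "(A ** Omega ** transpose B) $ r $ s = symp_form (A $ r) (B $ s)"
proof -
  have "(A ** Omega ** transpose B) $ r $ s = (\<Sum>c\<in>UNIV. (A ** Omega) $ r $ c * B $ s $ c)"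
    by (simp add: matrix_matrix_mult_def[of "A ** Omega"] transpose_def)
  then show ?thesis
    by (simp add: symp_form_eq_Omega row_matrix_mult)
qed

lemma linear_vector_matrix_mult:
  "Vector_Spaces.linear (*s) (*s) (\<lambda>x. x v* (Q :: 'a::field ^ 'm ^ 'n))"
  by unfold_locales (simp_all add: vec_eq_iff vector_matrix_mult_def sum.distrib sum_distrib_left algebra_simps)

lemma matrix_inv_invertible:
  assumes "invertible A"
  shows "A ** matrix_inv A = mat 1" "matrix_inv A ** A = mat 1"
  using someI_ex[OF assms[unfolded invertible_def]] by (simp_all add: matrix_inv_def)

lemma inj_vector_matrix_mult:
  fixes Q :: "'a::field ^ 'm ^ 'm"
  assumes "invertible Q"
  shows "inj (\<lambda>x. x v* Q)"
proof (rule inj_on_inverseI)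
  show "(x v* Q) v* matrix_inv Q = x" for x
    using assms by (simp add: vector_matrix_mul_assoc matrix_inv_invertible)
qed

lemma symp_form_symp_group:
  fixes Q :: "'a::field ^ ('n::finite + 'n) ^ ('n + 'n)"
  assumes "Q \<in> symp_group"
  shows "symp_form (x v* Q) (y v* Q) = symp_form x y"
proof -
  \<comment> \<open>Matrices with all rows equal to \<open>x\<close> (resp. \<open>y\<close>) turn
    the values of the form into entries of a Gram matrix.\<close>
  define X Y :: "'a ^ ('n + 'n) ^ ('n + 'n)" where "X = (\<chi> r. x)" and "Y = (\<chi> r. y)"
  have "(X ** Q) ** Omega ** transpose (Y ** Q) = X ** (Q ** Omega ** transpose Q) ** transpose Y"
    by (simp add: matrix_transpose_mul matrix_mul_assoc)
  also have "\<dots> = X ** Omega ** transpose Y"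
    using assms by (simp add: symp_group_def)
  finally have "symp_form ((X ** Q) $ r) ((Y ** Q) $ r) = symp_form (X $ r) (Y $ r)" for r
    by (metis gram_matrix)
  then show ?thesis
    by (simp add: row_matrix_mult X_def Y_def)
qed

lemma symp_group_inv_mult:
  assumes A: "A \<in> symp_group" and B: "B \<in> symp_group"
  shows "matrix_inv A ** B \<in> symp_group"
proof -
  let ?A' = "matrix_inv A"
  have inv: "A ** ?A' = mat 1" "?A' ** A = mat 1"
    using A by (simp_all add: symp_group_def matrix_inv_invertible)
  have "(?A' ** B) ** Omega ** transpose (?A' ** B)
      = ?A' ** (B ** Omega ** transpose B) ** transpose ?A'"
    by (simp add: matrix_transpose_mul matrix_mul_assoc)
  \<comment> \<open>Both Gram matrices equal \<open>Omega\<close>, so that of \<open>B\<close> may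
    be exchanged for that of \<open>A\<close>, which cancels against the inverse.\<close>
  also have "\<dots> = ?A' ** (A ** Omega ** transpose A) ** transpose ?A'"
    using A B by (simp add: symp_group_def)
  also have "\<dots> = (?A' ** A) ** Omega ** transpose (?A' ** A)"
    by (simp add: matrix_transpose_mul matrix_mul_assoc)
  finally have "(?A' ** B) ** Omega ** transpose (?A' ** B) = Omega"
    by (simp add: inv)
  moreover have "invertible (?A' ** B)"
  proof (rule invertible_mult)
    show "invertible ?A'"
      using inv by (auto simp: invertible_def)
    show "invertible B"
      using B by (simp add: symp_group_def)
  qed
  ultimately show ?thesis
    by (simp add: symp_group_def)
qed

lemma invertible_Omega: "invertible (Omega :: 'a::field ^ ('n::finite + 'n) ^ ('n + 'n))"
proof -
  have "x = 0" if "x v* Omega = 0" for x :: "'a ^ ('n + 'n)"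
  proof (rule ccontr)
    assume "x \<noteq> 0"
    then obtain y where "symp_form x y \<noteq> 0"
      using symp_LCD_UNIV by (auto simp: symp_LCD_iff)
    with that show False
      by (simp add: symp_form_eq_Omega)
  qed
  \<comment> \<open>As \<open>x v* Omega\<close> is \<open>transpose Omega *v x\<close>, the
    transpose has trivial kernel and hence a left inverse.\<close>
  then have "\<exists>B :: 'a ^ ('n + 'n) ^ ('n + 'n). B ** transpose Omega = mat 1"
    by (simp add: matrix_left_invertible_ker)
  then show ?thesis
    unfolding left_invertible_transpose invertible_right_inverse .
qed

text \<open>Since \<open>Omega\<close> is invertible, the Gram condition itself yields a right
  inverse of the square matrix \<open>B\<close>.\<close>

lemma symp_groupI:
  fixes B :: "'a::field ^ ('n::finite + 'n) ^ ('n + 'n)"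
  assumes "B ** Omega ** transpose B = Omega"
  shows "B \<in> symp_group"
proof -
  obtain W :: "'a ^ ('n + 'n) ^ ('n + 'n)" where "Omega ** W = mat 1"
    using invertible_Omega by (auto simp: invertible_def)
  then have "B ** (Omega ** transpose B ** W) = mat 1"
    using assms by (simp add: matrix_mul_assoc)
  then have "invertible B"
    using invertible_right_inverse by blast
  with assms show ?thesis
    by (simp add: symp_group_def)
qed

text \<open>Right multiplication by \<open>Q\<close> is an injective linear map preserving the form,
  so dimension and nondegeneracy pass to the image.\<close>

lemma code_mult_symp_LCD:
  fixes C :: "('a::{field,finite} ^ ('n::finite + 'n)) set"
  assumes Q: "Q \<in> symp_group" and C: "linear_code m d q C" "symp_LCD C"
  shows "linear_code m d q (code_mult C Q)" "symp_LCD (code_mult C Q)"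
proof -
  have sub: "vec.subspace C"
    using C by (simp add: linear_code_def)
  have inj: "inj (\<lambda>x. x v* Q)"
    using Q by (intro inj_vector_matrix_mult) (simp add: symp_group_def)
  have sub': "vec.subspace (code_mult C Q)"
    unfolding code_mult_def by (rule vec.linear_subspace_image[OF linear_vector_matrix_mult sub])
  have "vec.dim (code_mult C Q) = vec.dim C"
    unfolding code_mult_def
    by (rule vec.dim_image_eq[OF linear_vector_matrix_mult inj_on_subset[OF inj]]) simp
  with sub' C show "linear_code m d q (code_mult C Q)"
    by (simp add: linear_code_def)
  have "\<exists>y\<in>C. symp_form (x v* Q) (y v* Q) \<noteq> 0" if "x \<in> C" "x v* Q \<noteq> 0" for x
  proof -
    have "x \<noteq> 0"
      using that by (auto simp: vector_matrix_mult_0)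
    then show ?thesis
      using C(2) \<open>x \<in> C\<close> by (simp add: symp_LCD_iff[OF sub] symp_form_symp_group[OF Q])
  qed
  then show "symp_LCD (code_mult C Q)"
    unfolding symp_LCD_iff[OF sub'] unfolding code_mult_def by blast
qed

subsection \<open>Symplectic bases\<close>

text \<open>A partial symplectic basis stored in a full square matrix: rows with index outside
  \<open>I <+> I\<close> are arbitrary. With \<open>I = UNIV\<close> the matrix is
  symplectic.\<close>

definition symp_family :: "'n set \<Rightarrow> 'a::field ^ ('n::finite + 'n) ^ ('n + 'n) \<Rightarrow> bool" where
  "symp_family I B \<longleftrightarrow> (\<forall>r\<in>I <+> I. \<forall>s\<in>I <+> I. symp_form (B $ r) (B $ s) = Omega $ r $ s)"

text \<open>The form is nondegenerate on the span of a symplectic family, which makes an orthogonal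
  projection onto that span available.\<close>

lemma symp_family_projection:
  fixes v :: "'a::field ^ ('n::finite + 'n)"
  assumes fam: "symp_family I B"
  obtains u where "u \<in> vec.span ((\<lambda>r. B $ r) ` (I <+> I))"
    and "\<And>r. r \<in> I <+> I \<Longrightarrow> symp_form (v - u) (B $ r) = 0"
proof
  \<comment> \<open>The coefficient of each basis vector is the pairing of \<open>v\<close> with its
    partner; the minus sign compensates the value -1 of the form on (\<open>Inr i\<close>,
    \<open>Inl i\<close>).\<close>
  define u where "u = (\<Sum>i\<in>I. symp_form v (B $ Inr i) *s B $ Inl i - symp_form v (B $ Inl i) *s B $ Inr i)"
  show "u \<in> vec.span ((\<lambda>r. B $ r) ` (I <+> I))"
    unfolding u_def
    by (intro vec.span_sum vec.span_diff vec.span_scale vec.span_base imageI InlI InrI)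
  show "symp_form (v - u) (B $ r) = 0" if "r \<in> I <+> I" for r
  proof (cases r)
    case (Inl j)
    with that have j: "j \<in> I" by auto
    have "symp_form (B $ s) (B $ r) = Omega $ s $ Inl j" if "s \<in> I <+> I" for s
      using fam j Inl that by (simp add: symp_family_def InlI InrI)
    then have "symp_form u (B $ r) = (\<Sum>i\<in>I. if i = j then symp_form v (B $ Inl i) else 0)"
      unfolding u_def symp_form_sum_left
      by (intro sum.cong) (simp_all add: symp_form_diff_left symp_form_scale_left InlI InrI Omega_def)
    with j Inl show ?thesis
      by (simp add: symp_form_diff_left)
  next
    case (Inr j)
    with that have j: "j \<in> I" by auto
    have "symp_form (B $ s) (B $ r) = Omega $ s $ Inr j" if "s \<in> I <+> I" for s
      using fam j Inr that by (simp add: symp_family_def InlI InrI)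
    then have "symp_form u (B $ r) = (\<Sum>i\<in>I. if i = j then symp_form v (B $ Inr i) else 0)"
      unfolding u_def symp_form_sum_left
      by (intro sum.cong) (simp_all add: symp_form_diff_left symp_form_scale_left InlI InrI Omega_def)
    with j Inr show ?thesis
      by (simp add: symp_form_diff_left)
  qed
qed

text \<open>One step of symplectic Gram-Schmidt: a hyperbolic pair \<open>x\<close>,
  \<open>y\<close> in \<open>C\<close>, orthogonal to the rows already chosen, is placed at the
  index \<open>j\<close>.\<close>

lemma symp_family_insert:
  fixes B :: "'a::field ^ ('n::finite + 'n) ^ ('n + 'n)"
  assumes C: "vec.subspace C" "symp_LCD C"
    and fam: "symp_family I B" and rows: "\<And>r. r \<in> I <+> I \<Longrightarrow> B $ r \<in> C"
    and j: "j \<notin> I" and less: "2 * card I < vec.dim C"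
  obtains B' where "symp_family (insert j I) B'" "\<And>r. r \<in> insert j I <+> insert j I \<Longrightarrow> B' $ r \<in> C"
    "\<And>r. r \<in> I <+> I \<Longrightarrow> B' $ r = B $ r"
proof -
  let ?S = "(\<lambda>r. B $ r) ` (I <+> I)"
  have span: "vec.span ?S \<subseteq> C"
    using rows C(1) by (intro vec.span_minimal) auto
  \<comment> \<open>At most \<open>2 * card I\<close> rows cannot span \<open>C\<close>, which
    leaves a vector \<open>v\<close> outside their span.\<close>
  have "vec.dim ?S \<le> card ?S"
    by (rule vec.dim_le_card') simp
  also have "\<dots> \<le> card (I <+> I)"
    by (rule card_image_le) simp
  also have "\<dots> < vec.dim C"
    using less by (simp add: card_Plus)
  finally have "vec.span ?S \<noteq> C"
    using vec.dim_span by (metis less_irrefl)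
  with span obtain v where v: "v \<in> C" "v \<notin> vec.span ?S"
    by auto
  obtain u where u: "u \<in> vec.span ?S" "\<And>r. r \<in> I <+> I \<Longrightarrow> symp_form (v - u) (B $ r) = 0"
    using symp_family_projection[OF fam] by blast
  \<comment> \<open>Removing the projection of \<open>v\<close> leaves a vector orthogonal to the
    family, nonzero because \<open>v\<close> lies outside the span.\<close>
  define x where "x = v - u"
  have x: "x \<in> C" "x \<noteq> 0" "\<And>r. r \<in> I <+> I \<Longrightarrow> symp_form x (B $ r) = 0"
    using v u span C(1) by (auto simp: x_def intro!: vec.subspace_diff)
  obtain w where w: "w \<in> C" "symp_form x w \<noteq> 0"
    using C x by (auto simp: symp_LCD_iff)
  \<comment> \<open>Nondegeneracy on \<open>C\<close> provides a partner \<open>w\<close> for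
    \<open>x\<close>; scaling makes the pairing 1.\<close>
  define w' where "w' = (1 / symp_form x w) *s w"
  obtain u' where u': "u' \<in> vec.span ?S" "\<And>r. r \<in> I <+> I \<Longrightarrow> symp_form (w' - u') (B $ r) = 0"
    using symp_family_projection[OF fam] by blast
  define y where "y = w' - u'"
  \<comment> \<open>Since \<open>x\<close> is orthogonal to the whole span, subtracting
    \<open>u'\<close> from \<open>w'\<close> does not disturb the pairing with
    \<open>x\<close>.\<close>
  have "vec.span ?S \<subseteq> {z. symp_form x z = 0}"
  proof (rule vec.span_minimal)
    show "?S \<subseteq> {z. symp_form x z = 0}"
      using x(3) by blast
    have "vec.subspace {z. symp_form z x = 0}"
      by (rule vec.subspaceI) (simp_all add: symp_form_zero_left symp_form_add_left symp_form_scale_left)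
    moreover have "{z. symp_form z x = 0} = {z. symp_form x z = 0}"
      by (simp add: symp_form_swap[of _ x])
    ultimately show "vec.subspace {z. symp_form x z = 0}"
      by simp
  qed
  then have xy: "symp_form x y = 1"
    using u'(1) w(2) by (auto simp: y_def w'_def symp_form_diff_right symp_form_scale_right)
  have y: "y \<in> C" "\<And>r. r \<in> I <+> I \<Longrightarrow> symp_form y (B $ r) = 0"
    using w u' span C(1) by (auto simp: y_def w'_def intro!: vec.subspace_diff vec.subspace_scale)
  define B' where "B' = (\<chi> r. if r = Inl j then x else if r = Inr j then y else B $ r)"
  have B'[simp]: "B' $ Inl j = x" "B' $ Inr j = y" "\<And>r. r \<in> I <+> I \<Longrightarrow> B' $ r = B $ r"
    using j by (auto simp: B'_def)
  have idx: "insert j I <+> insert j I = insert (Inl j) (insert (Inr j) (I <+> I))"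
    by auto
  have Omega_j: "Omega $ Inl j $ r = (0 :: 'a)" "Omega $ Inr j $ r = (0 :: 'a)"
      "Omega $ r $ Inl j = (0 :: 'a)" "Omega $ r $ Inr j = (0 :: 'a)" if "r \<in> I <+> I" for r
    using that j by (auto simp: Omega_def)
  have Omega_jj: "Omega $ Inl j $ Inl j = (0 :: 'a)" "Omega $ Inl j $ Inr j = (1 :: 'a)"
      "Omega $ Inr j $ Inl j = (- 1 :: 'a)" "Omega $ Inr j $ Inr j = (0 :: 'a)"
    by (simp_all add: Omega_def)
  have "symp_form (B $ r) x = 0" "symp_form (B $ r) y = 0" if "r \<in> I <+> I" for r
    using that x(3) y(2) symp_form_swap[of "B $ r"] by simp_all
  moreover have "symp_form y x = -1"
    using xy symp_form_swap[of y x] by simp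
  ultimately have "symp_family (insert j I) B'"
    using fam xy x(3) y(2) unfolding symp_family_def idx ball_simps
    by (simp add: Omega_j Omega_jj symp_form_self)
  moreover have "B' $ r \<in> C" if "r \<in> insert j I <+> insert j I" for r
    using that x(1) y(1) rows unfolding idx by (metis B' insertE)
  ultimately show thesis
    using that B'(3) by blast
qed

text \<open>Hyperbolic pairs are added one index of \<open>J\<close> at a time while the old rows
  stay fixed. This serves both to build a basis inside a code and to complete it in the ambient
  space.\<close>

lemma symp_family_extend:
  fixes B :: "'a::field ^ ('n::finite + 'n) ^ ('n + 'n)"
  assumes C: "vec.subspace C" "symp_LCD C"
    and fam: "symp_family I B" and rows: "\<And>r. r \<in> I <+> I \<Longrightarrow> B $ r \<in> C"
    and card: "2 * card (I \<union> J) \<le> vec.dim C"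
  shows "\<exists>B'. symp_family (I \<union> J) B' \<and> (\<forall>r\<in>(I \<union> J) <+> (I \<union> J). B' $ r \<in> C) \<and>
           (\<forall>r\<in>I <+> I. B' $ r = B $ r)"
proof -
  have "finite J" by simp
  from this card show ?thesis
  proof (induction J)
    case empty
    with fam rows show ?case by auto
  next
    case (insert j J)
    have "card (I \<union> J) \<le> card (I \<union> insert j J)"
      by (intro card_mono) auto
    with insert obtain B' where B': "symp_family (I \<union> J) B'"
        "\<And>r. r \<in> (I \<union> J) <+> (I \<union> J) \<Longrightarrow> B' $ r \<in> C" "\<And>r. r \<in> I <+> I \<Longrightarrow> B' $ r = B $ r"
      by fastforce
    show ?case
    proof (cases "j \<in> I")
      case True
      then have "I \<union> insert j J = I \<union> J" by auto
      with B' show ?thesis by metis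
    next
      case False
      with insert.hyps have j: "j \<notin> I \<union> J" by simp
      \<comment> \<open>The new index \<open>j\<close> raises the cardinality by one, so the bound
        for the enlarged set is strict for \<open>I \<union> J\<close>.\<close>
      with insert.prems have "2 * card (I \<union> J) < vec.dim C" by simp
      from symp_family_insert[OF C B'(1,2) j this] obtain B'' where
        "symp_family (insert j (I \<union> J)) B''"
        "\<And>r. r \<in> insert j (I \<union> J) <+> insert j (I \<union> J) \<Longrightarrow> B'' $ r \<in> C"
        "\<And>r. r \<in> (I \<union> J) <+> (I \<union> J) \<Longrightarrow> B'' $ r = B' $ r"
        by blast
      moreover have "r \<in> (I \<union> J) <+> (I \<union> J)" if "r \<in> I <+> I" for r
        using that by auto
      ultimately show ?thesis
        using B'(3) by (intro exI[of _ B'']) simp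
    qed
  qed
qed

text \<open>The rows are the images of the standard basis vectors under the injective linear map
  \<open>\<lambda>x. x v* B\<close>.\<close>

lemma independent_rows_invertible:
  fixes B :: "'a::field ^ 'm ^ 'm"
  assumes "invertible B"
  shows "vec.independent (range (\<lambda>r. B $ r))" "inj (\<lambda>r. B $ r)"
proof -
  have row: "B $ r = axis r 1 v* B" for r
    by (simp add: vec_eq_iff vector_matrix_mult_def axis_def if_distrib[where f = "\<lambda>t. t * _"]
        cong: if_cong)
  note inj = inj_vector_matrix_mult[OF assms]
  have "vec.independent ((\<lambda>x. x v* B) ` cart_basis)"
    using inj by (intro vec.linear_independent_injective_image[OF linear_vector_matrix_mult
          independent_cart_basis]) (auto intro: inj_on_subset)
  moreover have "(\<lambda>x. x v* B) ` cart_basis = range (\<lambda>r. B $ r)"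
    by (auto simp: cart_basis_def row)
  ultimately show "vec.independent (range (\<lambda>r. B $ r))" by simp
  show "inj (\<lambda>r. B $ r)"
    unfolding row using inj by (intro injI) (auto dest!: injD simp: axis_eq_axis)
qed

lemma symp_LCD_obtain_basis:
  fixes C :: "('a::field ^ ('n::finite + 'n)) set"
  assumes C: "vec.subspace C" "symp_LCD C" and dim: "vec.dim C = 2 * card I"
  obtains B where "B \<in> symp_group" "C = vec.span ((\<lambda>r. B $ r) ` (I <+> I))"
proof -
  \<comment> \<open>The empty family imposes no condition, so any matrix can start the
    extension.\<close>
  have "symp_family {} (undefined :: 'a ^ ('n + 'n) ^ ('n + 'n))"
    by (auto simp: symp_family_def)
  from symp_family_extend[OF C this, of I] obtain A where
    A: "symp_family I A" "\<And>r. r \<in> I <+> I \<Longrightarrow> A $ r \<in> C"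
    using dim by auto
  \<comment> \<open>The ambient space has dimension exactly twice the number of indices, so the
    family extends to all of them.\<close>
  have "2 * card (I \<union> UNIV) \<le> vec.dim (UNIV :: ('a ^ ('n + 'n)) set)"
    by (simp add: vec.dim_UNIV card_cart_basis)
  from symp_family_extend[OF vec.subspace_UNIV symp_LCD_UNIV A(1) _ this] obtain B where
    B: "symp_family UNIV B" "\<And>r. r \<in> I <+> I \<Longrightarrow> B $ r = A $ r"
    by auto
  let ?S = "(\<lambda>r. B $ r) ` (I <+> I)"
  have "B ** Omega ** transpose B = Omega"
    using B(1) by (simp add: symp_family_def vec_eq_iff gram_matrix)
  then have grp: "B \<in> symp_group"
    by (rule symp_groupI)
  then have "invertible B"
    by (simp add: symp_group_def)
  note ind = independent_rows_invertible[OF this]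
  have "vec.independent ?S"
    by (rule vec.independent_mono[OF ind(1)]) auto
  moreover have "card ?S = 2 * card I"
    using inj_on_subset[OF ind(2)] by (simp add: card_image card_Plus)
  moreover have S: "?S \<subseteq> C"
    using A(2) B(2) by auto
  \<comment> \<open>The rows indexed by \<open>I <+> I\<close> are as many independent vectors of
    \<open>C\<close> as its dimension, hence they span it.\<close>
  ultimately have "C \<subseteq> vec.span ?S"
    using dim by (intro vec.card_ge_dim_independent) auto
  moreover have "vec.span ?S \<subseteq> C"
    using S C(1) by (rule vec.span_minimal)
  ultimately show thesis
    using that grp by blast
qed

lemma symp_LCD_transitive:
  fixes C\<^sub>1 C\<^sub>2 :: "('a::field ^ ('n::finite + 'n)) set"
  assumes C1: "vec.subspace C\<^sub>1" "symp_LCD C\<^sub>1" "vec.dim C\<^sub>1 = 2 * k"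
    and C2: "vec.subspace C\<^sub>2" "symp_LCD C\<^sub>2" "vec.dim C\<^sub>2 = 2 * k"
  shows "\<exists>Q\<in>symp_group. C\<^sub>2 = code_mult C\<^sub>1 Q"
proof -
  have "vec.dim C\<^sub>1 \<le> vec.dim (UNIV :: ('a ^ ('n + 'n)) set)"
    by (rule vec.dim_subset) simp
  then have "k \<le> CARD('n)"
    using C1(3) by (simp add: vec.dim_UNIV card_cart_basis)
  \<comment> \<open>One index set serves both codes, so that corresponding rows of the two bases can
    be matched.\<close>
  then obtain I :: "'n set" where I: "card I = k"
    using obtain_subset_with_card_n by metis
  obtain B\<^sub>1 where B1: "B\<^sub>1 \<in> symp_group" "C\<^sub>1 = vec.span ((\<lambda>r. B\<^sub>1 $ r) ` (I <+> I))"
    using symp_LCD_obtain_basis[OF C1(1,2)] C1(3) I by metis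
  obtain B\<^sub>2 where B2: "B\<^sub>2 \<in> symp_group" "C\<^sub>2 = vec.span ((\<lambda>r. B\<^sub>2 $ r) ` (I <+> I))"
    using symp_LCD_obtain_basis[OF C2(1,2)] C2(3) I by metis
  let ?Q = "matrix_inv B\<^sub>1 ** B\<^sub>2"
  have "B\<^sub>1 ** ?Q = B\<^sub>2"
    using B1(1) by (simp add: symp_group_def matrix_mul_assoc matrix_inv_invertible)
  then have "B\<^sub>1 $ r v* ?Q = B\<^sub>2 $ r" for r
    by (metis row_matrix_mult)
  \<comment> \<open>\<open>?Q\<close> sends each spanning row of the first code to the row of the
    second with the same index, and linearity carries span to span.\<close>
  then have "code_mult C\<^sub>1 ?Q = C\<^sub>2"
    unfolding code_mult_def B1(2) B2(2)
    by (simp add: vec.linear_span_image[OF linear_vector_matrix_mult, symmetric] image_image)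
  then show ?thesis
    using symp_group_inv_mult[OF B1(1) B2(1)] by blast
qed

theorem theorem4p6:
  fixes n k q :: nat
  shows "(\<forall>C\<^sub>1 C\<^sub>2 :: ('a :: {field, finite} ^ ('n :: finite + 'n)) set.
            linear_code (2 * n) (2 * k) q C\<^sub>1 \<and> symp_LCD C\<^sub>1 \<and>
            linear_code (2 * n) (2 * k) q C\<^sub>2 \<and> symp_LCD C\<^sub>2 \<longrightarrow>
            (\<exists>Q \<in> symp_group. C\<^sub>2 = code_mult C\<^sub>1 Q)) \<and>
         (\<forall>(C :: ('a ^ ('n + 'n)) set). \<forall>Q \<in> symp_group.
            linear_code (2 * n) (2 * k) q C \<and> symp_LCD C \<longrightarrow>
            linear_code (2 * n) (2 * k) q (code_mult C Q) \<and> symp_LCD (code_mult C Q))"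
proof (intro conjI allI impI ballI)
  fix C\<^sub>1 C\<^sub>2 :: "('a ^ ('n + 'n)) set"
  assume "linear_code (2 * n) (2 * k) q C\<^sub>1 \<and> symp_LCD C\<^sub>1 \<and>
    linear_code (2 * n) (2 * k) q C\<^sub>2 \<and> symp_LCD C\<^sub>2"
  then show "\<exists>Q\<in>symp_group. C\<^sub>2 = code_mult C\<^sub>1 Q"
    by (intro symp_LCD_transitive[of _ k]) (simp_all add: linear_code_def)
qed (use code_mult_symp_LCD in blast)+

end
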